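(* Let $d,k\ge 1$ be integers, let $N\in\{dk,dk+1\}$, and let $S_{\mathbf a}\subset\mathbb R^d$ be the one-row Hermite normal form simplex associated with $\mathbf a=(N-1,\ldots,N-1,N)\in\mathbb N^d$. Then $$h^\ast_{S_{\mathbf a}}(t)=\begin{cases}1+k\displaystyle\sum_{j=1}^{d-1}t^j+(k-1)t^d,&\text{if }N=dk,\\ 1+k\displaystyle\sum_{j=1}^{d}t^j,&\text{if }N=dk+1.\end{cases}$$ Moreover, the local $h^\ast$-polynomial is $$\ell^\ast_{S_{\mathbf a}}(t)=\begin{cases}(k-1)\displaystyle\sum_{i=1}^{d}t^i,&\text{if }N=dk,\\ k\displaystyle\sum_{i=1}^{d}t^i,&\text{if }N=dk+1.\end{cases}$$
   Context: For $\mathbf a=(a_1,\ldots,a_{d-1},N)\in\mathbb Z^d$ with $0\le a_i<N$, the one-row Hermite normal form simplex $S_{\mathbf a}$ is the convex hull in $\mathbb R^d$ of $\mathbf v_0=\mathbf 0$, $\mathbf v_i=\mathbf e_i$ (standard unit vectors) for $1\le i\le d-1$, and $\mathbf v_d=\mathbf a$. For a $d$-dimensional lattice polytope $P\subset\mathbb R^d$, the $h^\ast$-polynomial $h^\ast_P(t)$ is the polynomial of degree at most $d$ defined by $\sum_{m\ge0}|mP\cap\mathbb Z^d|\,t^m=h^\ast_P(t)/(1-t)^{d+1}$. For a $d$-dimensional lattice simplex $S$ with vertices $\mathbf v_0,\ldots,\mathbf v_d$, let $A$ be the $(d+1)\times(d+1)$ matrix with rows $(1,\mathbf v_i)$, let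 $\Lambda=\mathbb Z^{d+1}A^{-1}$ (row vectors), and $\Gamma=\Lambda/\mathbb Z^{d+1}$, whose elements are identified with their unique representatives in $[0,1)^{d+1}$. For $\mathbf x\in\Gamma$ (so represented) let $\mathrm{age}(\mathbf x)=\sum_{i=0}^d x_i$. The local $h^\ast$-polynomial is $\ell^\ast_S(t)=\sum_{\mathbf x\in\Gamma\cap(0,1)^{d+1}}t^{\mathrm{age}(\mathbf x)}$. *)

theory Defs
  imports "HOL-Analysis.Analysis" "HOL-Computational_Algebra.Polynomial_FPS"
begin

unbundle no fps_syntax

text \<open>
  The ambient space \<open>\<real>\<^sup>d\<close> is \<open>real ^ 'n\<close> with \<open>d = CARD('n)\<close>. The \<open>d + 1\<close> vertices
  \<open>v\<^sub>0, \<dots>, v\<^sub>d\<close> of a simplex are a family indexed by \<open>'n option\<close>: \<open>None\<close> stands for the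
  index 0 and \<open>Some i\<close> for the index of the coordinate \<open>i\<close>. The same type indexes the
  rows and columns of \<open>(d + 1) \<times> (d + 1)\<close> matrices.
\<close>

definition integer_points :: "(real ^ 'm) set" where
  "integer_points = {x. \<forall>i. x $ i \<in> \<int>}"

text \<open>
  The coordinates of \<open>'n\<close> are unordered, so the last coordinate is a parameter \<open>l\<close>:
  the remaining coordinates play the role of \<open>1, \<dots>, d - 1\<close>, and \<open>a $ l\<close> is the entry \<open>N\<close>.
\<close>

definition hnf_vertices :: "'n \<Rightarrow> int ^ 'n \<Rightarrow> 'n option \<Rightarrow> real ^ 'n" where
  "hnf_vertices l a i =
     (case i of
        None \<Rightarrow> 0
      | Some j \<Rightarrow> if j = l then (\<chi> m. of_int (a $ m)) else axis j 1)"

definition hnf_simplex :: "'n::finite \<Rightarrow> int ^ 'n \<Rightarrow> (real ^ 'n) set" where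
  "hnf_simplex l a = convex hull (range (hnf_vertices l a))"

definition ehrhart_series :: "(real ^ 'n) set \<Rightarrow> real fps" where
  "ehrhart_series P =
     Abs_fps (\<lambda>m. of_nat (card ((\<lambda>x. real m *\<^sub>R x) ` P \<inter> integer_points)))"

text \<open>The following is meant for full-dimensional lattice polytopes, where such a polynomial exists.\<close>

definition hstar :: "(real ^ 'n::finite) set \<Rightarrow> real poly" where
  "hstar P = (THE p. degree p \<le> CARD('n) \<and>
     ehrhart_series P = fps_of_poly p / (1 - fps_X) ^ (CARD('n) + 1))"

lemma hstar_eqI:
  fixes P :: "(real ^ 'n::finite) set"
  assumes "degree p \<le> CARD('n)"
    and "ehrhart_series P = fps_of_poly p / (1 - fps_X) ^ (CARD('n) + 1)"
  shows "hstar P = p"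
proof -
  have nz: "fps_nth ((1 - fps_X :: real fps) ^ (CARD('n) + 1)) 0 \<noteq> 0"
    by (simp add: fps_nth_power_0)
  have "q = p" if "ehrhart_series P = fps_of_poly q / (1 - fps_X) ^ (CARD('n) + 1)" for q
  proof -
    have "fps_of_poly q = fps_of_poly p"
      using that assms(2) nz
      by (metis fps_divide_unit fps_inverse_eq_0_iff mult_right_cancel fps_zero_nth)
    then show ?thesis by (simp add: fps_of_poly_eq_iff)
  qed
  with assms show ?thesis unfolding hstar_def by blast
qed

definition homogenized_matrix ::
    "('n option \<Rightarrow> real ^ 'n) \<Rightarrow> real ^ ('n::finite) option ^ 'n option" where
  "homogenized_matrix v =
     (\<chi> i j. case j of None \<Rightarrow> 1 | Some c \<Rightarrow> v i $ c)"

definition simplex_lattice :: "('n option \<Rightarrow> real ^ 'n) \<Rightarrow> (real ^ ('n::finite) option) set" where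
  "simplex_lattice v = (\<lambda>z. z v* matrix_inv (homogenized_matrix v)) ` integer_points"

text \<open>
  The quotient \<open>\<Gamma> = \<Lambda> / \<int>\<^sup>d\<^sup>+\<^sup>1\<close> is represented by the unique representatives of its elements
  in \<open>[0, 1)\<^sup>d\<^sup>+\<^sup>1\<close>; these are exactly the points of \<open>\<Lambda>\<close> in that cube, as \<open>\<int>\<^sup>d\<^sup>+\<^sup>1 \<subseteq> \<Lambda>\<close>.
\<close>

definition simplex_group :: "('n option \<Rightarrow> real ^ 'n) \<Rightarrow> (real ^ ('n::finite) option) set" where
  "simplex_group v = {x \<in> simplex_lattice v. \<forall>i. 0 \<le> x $ i \<and> x $ i < 1}"

definition age :: "real ^ 'm \<Rightarrow> real" where
  "age x = (\<Sum>i\<in>UNIV. x $ i)"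

text \<open>
  The age of an element of \<open>\<Gamma>\<close> is a natural number, since the first column of the matrix
  consists of ones; the floor below only converts it to the type of exponents.
\<close>

definition local_hstar :: "('n option \<Rightarrow> real ^ 'n::finite) \<Rightarrow> real poly" where
  "local_hstar v =
     (\<Sum>x \<in> {x \<in> simplex_group v. \<forall>i. 0 < x $ i \<and> x $ i < 1}. monom 1 (nat \<lfloor>age x\<rfloor>))"

end

theory Submission
  imports Defs
begin

text \<open>
  A lattice point of \<open>mS\<close> is determined by its barycentric coordinates, a nonnegative point of
  \<open>\<Lambda>\<close> of age \<open>m\<close>. Splitting such a point into fractional and integral parts gives an element
  \<open>x\<close> of \<open>\<Gamma>\<close> and a vector of \<open>d + 1\<close> natural numbers with sum \<open>m - age x\<close>, whence
  \<open>h\<^sup>*(t) = \<Sum>x\<in>\<Gamma>. t ^ age x\<close>. For the simplex in question \<open>\<Gamma>\<close> is cyclic: its elements have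
  coordinates \<open>j / N\<close> (\<open>0 \<le> j < N\<close>) at \<open>v\<^sub>1, \<dots>, v\<^sub>d\<close> and hence age \<open>\<lceil>d j / N\<rceil>\<close>. For both values
  of \<open>N\<close> this age is \<open>(j - 1) div k + 1\<close> when \<open>1 \<le> j \<le> d k\<close>, so that each exponent
  \<open>1, \<dots>, d\<close> occurs \<open>k\<close> times in this range.
\<close>

section \<open>Ehrhart series of lattice simplices\<close>

lemma sum_option_UNIV:
  fixes f :: "'n::finite option \<Rightarrow> 'b::comm_monoid_add"
  shows "(\<Sum>i\<in>UNIV. f i) = f None + (\<Sum>c\<in>UNIV. f (Some c))"
  by (simp add: UNIV_option_conv sum.reindex)

lemma card_option_UNIV: "CARD('n::finite option) = CARD('n) + 1"
  by (simp add: UNIV_option_conv card_image)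

text \<open>Reading a function along an enumeration \<open>h\<close> of its finite domain turns it
  into a list. \<open>natpermute\<close> is the index set in the coefficient formula for powers of a
  formal power series.\<close>

lemma card_fun_sum_eq_card_natpermute:
  "card {f :: 'm::finite \<Rightarrow> nat. sum f UNIV = s} = card (natpermute s CARD('m))"
proof -
  obtain h :: "nat \<Rightarrow> 'm" where h: "bij_betw h {0..<CARD('m)} UNIV"
    using ex_bij_betw_nat_finite[of "UNIV :: 'm set"] by auto
  define F where "F = (\<lambda>f :: 'm \<Rightarrow> nat. map (f \<circ> h) [0..<CARD('m)])"
  have sum_F: "sum_list (F f) = sum f UNIV" for f
    using sum.reindex_bij_betw[OF h, of f]
    by (simp add: F_def interv_sum_list_conv_sum_set_nat)
  have "bij_betw F {f. sum f UNIV = s} (natpermute s CARD('m))"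
  proof (rule bij_betw_imageI)
    show "inj_on F {f. sum f UNIV = s}"
    proof (rule inj_onI)
      fix f g assume "F f = F g"
      then have eq: "f (h i) = g (h i)" if "i < CARD('m)" for i
        using that by (simp add: F_def)
      show "f = g"
      proof
        fix x
        obtain i where "i < CARD('m)" "x = h i"
          using bij_betw_imp_surj_on[OF h] by (metis UNIV_I atLeastLessThan_iff imageE)
        with eq show "f x = g x" by simp
      qed
    qed
    show "F ` {f. sum f UNIV = s} = natpermute s CARD('m)"
    proof (intro equalityI subsetI)
      fix l assume "l \<in> F ` {f. sum f UNIV = s}"
      then show "l \<in> natpermute s CARD('m)"
        using sum_F by (auto simp: natpermute_def) (simp add: F_def)
    next
      fix l assume l: "l \<in> natpermute s CARD('m)"
      define f where "f = (\<lambda>x. l ! the_inv_into {0..<CARD('m)} h x)"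
      have "F f = l"
        using l h by (intro nth_equalityI)
          (auto simp: F_def f_def natpermute_def bij_betw_def the_inv_into_f_f)
      moreover from this have "sum f UNIV = s"
        using sum_F[of f] l by (simp add: natpermute_def)
      ultimately show "l \<in> F ` {f. sum f UNIV = s}" by blast
    qed
  qed
  then show ?thesis by (rule bij_betw_same_card)
qed

lemma finite_fun_sum_eq: "finite {f :: 'm::finite \<Rightarrow> nat. sum f UNIV = s}"
proof (rule finite_subset)
  show "{f :: 'm \<Rightarrow> nat. sum f UNIV = s} \<subseteq> PiE UNIV (\<lambda>_. {..s})"
  proof clarify
    fix f :: "'m \<Rightarrow> nat"
    have "f x \<le> sum f UNIV" for x by (rule member_le_sum) auto
    then show "f \<in> PiE UNIV (\<lambda>_. {..sum f UNIV})" by auto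
  qed
qed (auto intro: finite_PiE)

text \<open>The inverse of \<open>1 - fps_X\<close> has all coefficients 1, so every product in the
  coefficient formula for its powers is 1 and the coefficient just counts index vectors.\<close>

lemma fps_nth_inverse_one_minus_X_power:
  "fps_nth (inverse ((1 - fps_X :: real fps) ^ CARD('m::finite))) s =
     of_nat (card {f :: 'm \<Rightarrow> nat. sum f UNIV = s})"
proof -
  have prod_one: "(\<Prod>j\<in>{0..n}. fps_nth (Abs_fps (\<lambda>n. 1 :: real)) (v ! j)) = 1" for n and v :: "nat list"
    by simp
  obtain n where n: "CARD('m) = Suc n"
    using finite_UNIV_card_ge_0[where 'a = 'm] by (cases "CARD('m)") auto
  have "inverse ((1 - fps_X :: real fps) ^ CARD('m)) = Abs_fps (\<lambda>n. 1) ^ Suc n"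
    by (simp only: fps_inverse_power fps_inverse_one_minus_fps_X n)
  then show ?thesis
    by (simp only: fps_power_nth_Suc prod_one card_fun_sum_eq_card_natpermute n) simp
qed

section \<open>Barycentric coordinates of the lattice points in dilates\<close>

lemma convex_hull_range:
  fixes v :: "'m::finite \<Rightarrow> 'a::real_vector"
  shows "convex hull (range v) =
    {\<Sum>i\<in>UNIV. u i *\<^sub>R v i | u. (\<forall>i. 0 \<le> u i) \<and> sum u UNIV = 1}"
proof (intro hull_unique)
  show "range v \<subseteq> {\<Sum>i\<in>UNIV. u i *\<^sub>R v i | u. (\<forall>i. 0 \<le> u i) \<and> sum u UNIV = 1}"
  proof clarify
    fix i
    have "(\<Sum>j\<in>UNIV. (if j = i then 1 else 0) *\<^sub>R v j) = v i"
      by (simp add: if_distrib[of "\<lambda>c. c *\<^sub>R _"] cong: if_cong)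
    then show "\<exists>u. v i = (\<Sum>j\<in>UNIV. u j *\<^sub>R v j) \<and> (\<forall>j. 0 \<le> u j) \<and> sum u UNIV = 1"
      by (intro exI[of _ "\<lambda>j. if j = i then 1 else 0"]) auto
  qed
  show "convex {\<Sum>i\<in>UNIV. u i *\<^sub>R v i | u. (\<forall>i. 0 \<le> u i) \<and> sum u UNIV = 1}"
  proof (rule convexI, clarify)
    fix a b :: real and u w :: "'m \<Rightarrow> real"
    assume "0 \<le> a" "0 \<le> b" "a + b = 1" "\<forall>i. 0 \<le> u i" "\<forall>i. 0 \<le> w i"
      "sum u UNIV = 1" "sum w UNIV = 1"
    then show "\<exists>z. a *\<^sub>R (\<Sum>i\<in>UNIV. u i *\<^sub>R v i) + b *\<^sub>R (\<Sum>i\<in>UNIV. w i *\<^sub>R v i) =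
          (\<Sum>i\<in>UNIV. z i *\<^sub>R v i) \<and> (\<forall>i. 0 \<le> z i) \<and> sum z UNIV = 1"
      by (intro exI[of _ "\<lambda>i. a * u i + b * w i"])
        (auto simp: scaleR_sum_right scaleR_left_distrib sum.distrib sum_distrib_left[symmetric])
  qed
  fix T assume T: "range v \<subseteq> T" "convex T"
  show "{\<Sum>i\<in>UNIV. u i *\<^sub>R v i | u. (\<forall>i. 0 \<le> u i) \<and> sum u UNIV = 1} \<subseteq> T"
    using T by (auto intro!: convex_sum)
qed

text \<open>The column of ones produces the age and the other columns the point itself; this turns
  matrix statements about \<Lambda> into statements about barycentric coordinates.\<close>

lemma vector_homogenized_matrix:
  "x v* homogenized_matrix v =
    (\<chi> j. case j of None \<Rightarrow> age x | Some c \<Rightarrow> (\<Sum>i\<in>UNIV. x $ i *\<^sub>R v i) $ c)"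
  by (simp add: vec_eq_iff vector_matrix_mult_def homogenized_matrix_def age_def mult.commute
      split: option.split)

lemma simplex_lattice_iff:
  assumes "invertible (homogenized_matrix v)"
  shows "x \<in> simplex_lattice v \<longleftrightarrow> age x \<in> \<int> \<and> (\<Sum>i\<in>UNIV. x $ i *\<^sub>R v i) \<in> integer_points"
proof -
  let ?A = "homogenized_matrix v"
  \<comment> \<open>\<open>matrix_inv\<close> is a choice of two-sided inverse; invertibility
    provides a witness for it.\<close>
  have "matrix_inv ?A ** ?A = mat 1" "?A ** matrix_inv ?A = mat 1"
    using someI_ex[of "\<lambda>B. ?A ** B = mat 1 \<and> B ** ?A = mat 1"] assms
    by (auto simp: invertible_def matrix_inv_def)
  then have "x \<in> simplex_lattice v \<longleftrightarrow> x v* ?A \<in> integer_points"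
    unfolding simplex_lattice_def
    by (metis (no_types, lifting) imageE image_eqI vector_matrix_mul_assoc vector_matrix_mul_rid)
  then show ?thesis
    by (auto simp: integer_points_def vector_homogenized_matrix split: option.split)
qed

text \<open>This is affine independence of the vertices: both sides have the same image under the
  matrix, and a right inverse cancels it.\<close>

lemma barycentric_inject:
  assumes "invertible (homogenized_matrix v)"
    and "age x = age y" "(\<Sum>i\<in>UNIV. x $ i *\<^sub>R v i) = (\<Sum>i\<in>UNIV. y $ i *\<^sub>R v i)"
  shows "x = y"
proof -
  let ?A = "homogenized_matrix v"
  obtain B where "?A ** B = mat 1"
    using assms(1) by (auto simp: invertible_def)
  moreover have "x v* ?A = y v* ?A"
    using assms(2,3) by (simp only: vector_homogenized_matrix)
  ultimately show ?thesis
    by (metis vector_matrix_mul_assoc vector_matrix_mul_rid)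
qed

text \<open>Barycentric coordinates scaled by \<open>m\<close> have sum \<open>m\<close>. Given this
  integral age, membership in \<Lambda> says exactly that the point is integral.\<close>

lemma card_dilated_simplex_points:
  fixes v :: "'n::finite option \<Rightarrow> real ^ 'n"
  assumes "invertible (homogenized_matrix v)"
  shows "card ((\<lambda>x. real m *\<^sub>R x) ` (convex hull (range v)) \<inter> integer_points) =
    card {x \<in> simplex_lattice v. (\<forall>i. 0 \<le> x $ i) \<and> age x = real m}"
proof -
  define F where "F = (\<lambda>x :: real ^ 'n option. \<Sum>i\<in>UNIV. x $ i *\<^sub>R v i)"
  define L where "L = {x \<in> simplex_lattice v. (\<forall>i. 0 \<le> x $ i) \<and> age x = real m}"
  have "bij_betw F L ((\<lambda>x. real m *\<^sub>R x) ` (convex hull (range v)) \<inter> integer_points)"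
  proof (rule bij_betw_imageI)
    show "inj_on F L"
      by (rule inj_onI) (auto simp: F_def L_def intro: barycentric_inject[OF assms])
    show "F ` L = (\<lambda>x. real m *\<^sub>R x) ` (convex hull (range v)) \<inter> integer_points"
    proof (intro equalityI subsetI)
      fix p assume "p \<in> F ` L"
      then obtain x where x: "x \<in> L" "p = F x" by blast
      have "F x \<in> (\<lambda>x. real m *\<^sub>R x) ` (convex hull (range v))"
      proof (cases "m = 0")
        \<comment> \<open>Division by \<open>m\<close> is impossible here: age 0 forces all
          coordinates to vanish, and any vertex shows that the dilate by 0 contains the
          origin.\<close>
        case True
        with x have "\<forall>i. x $ i = 0"
          by (auto simp: L_def age_def sum_nonneg_eq_0_iff)
        moreover have "v None \<in> convex hull (range v)" by (rule hull_inc) simp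
        ultimately show ?thesis using True by (auto simp: F_def)
      next
        case False
        have "(\<Sum>i\<in>UNIV. (x $ i / m) *\<^sub>R v i) \<in> convex hull (range v)"
          unfolding convex_hull_range using x(1) False
          by (auto simp: L_def age_def sum_divide_distrib[symmetric]
              intro!: exI[of _ "\<lambda>i. x $ i / m"])
        moreover have "F x = real m *\<^sub>R (\<Sum>i\<in>UNIV. (x $ i / m) *\<^sub>R v i)"
          using False by (simp add: F_def scaleR_sum_right)
        ultimately show ?thesis by blast
      qed
      then show "p \<in> (\<lambda>x. real m *\<^sub>R x) ` (convex hull (range v)) \<inter> integer_points"
        using x by (simp add: L_def simplex_lattice_iff[OF assms] F_def)
    next
      fix p assume p: "p \<in> (\<lambda>x. real m *\<^sub>R x) ` (convex hull (range v)) \<inter> integer_points"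
      then obtain u where u: "p = real m *\<^sub>R (\<Sum>i\<in>UNIV. u i *\<^sub>R v i)" "\<forall>i. 0 \<le> u i" "sum u UNIV = 1"
        unfolding convex_hull_range by blast
      define x :: "real ^ 'n option" where "x = (\<chi> i. real m * u i)"
      have "F x = p" using u by (simp add: F_def x_def scaleR_sum_right)
      moreover have "age x = real m"
        using u by (simp add: age_def x_def sum_distrib_left[symmetric])
      ultimately have "x \<in> L"
        using u p by (simp add: L_def simplex_lattice_iff[OF assms] F_def) (simp add: x_def)
      with \<open>F x = p\<close> show "p \<in> F ` L" by blast
    qed
  qed
  from bij_betw_same_card[OF this] show ?thesis by (simp add: L_def)
qed

section \<open>Reduction of lattice points modulo integer vectors\<close>

lemma sum_scaleR_in_integer_points:
  fixes v :: "'m::finite \<Rightarrow> real ^ 'n"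
  assumes "\<And>i. v i \<in> integer_points" "\<And>i. u i \<in> \<int>"
  shows "(\<Sum>i\<in>UNIV. u i *\<^sub>R v i) \<in> integer_points"
  using assms by (auto simp: integer_points_def intro!: Ints_mult)

lemma integer_points_add: "x \<in> integer_points \<Longrightarrow> y \<in> integer_points \<Longrightarrow> x + y \<in> integer_points"
  by (auto simp: integer_points_def)

lemma integer_points_diff: "x \<in> integer_points \<Longrightarrow> y \<in> integer_points \<Longrightarrow> x - y \<in> integer_points"
  by (auto simp: integer_points_def)

text \<open>An integral coordinate vector has integral age and combines lattice vertices to a
  lattice point, so translating by it changes neither condition for \<Lambda>.\<close>

lemma simplex_lattice_add_integer:
  fixes v :: "'n::finite option \<Rightarrow> real ^ 'n"
  assumes inv: "invertible (homogenized_matrix v)" and int: "\<And>i. v i \<in> integer_points"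
    and z: "z \<in> integer_points"
  shows "x + z \<in> simplex_lattice v \<longleftrightarrow> x \<in> simplex_lattice v"
proof -
  have zv: "(\<Sum>i\<in>UNIV. z $ i *\<^sub>R v i) \<in> integer_points"
    using z int by (intro sum_scaleR_in_integer_points) (auto simp: integer_points_def)
  have agez: "age z \<in> \<int>"
    using z by (auto simp: age_def integer_points_def)
  have age_add: "age (x + z) = age x + age z"
    by (simp add: age_def sum.distrib)
  have comb_add: "(\<Sum>i\<in>UNIV. (x + z) $ i *\<^sub>R v i) =
      (\<Sum>i\<in>UNIV. x $ i *\<^sub>R v i) + (\<Sum>i\<in>UNIV. z $ i *\<^sub>R v i)"
    by (simp add: scaleR_left_distrib sum.distrib)
  have "age (x + z) \<in> \<int> \<longleftrightarrow> age x \<in> \<int>"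
    using agez Ints_diff[OF _ agez, of "age (x + z)"] by (auto simp: age_add)
  moreover have "(\<Sum>i\<in>UNIV. (x + z) $ i *\<^sub>R v i) \<in> integer_points \<longleftrightarrow>
      (\<Sum>i\<in>UNIV. x $ i *\<^sub>R v i) \<in> integer_points"
    using integer_points_add[OF _ zv] integer_points_diff[OF _ zv] unfolding comb_add
    by fastforce
  ultimately show ?thesis by (simp only: simplex_lattice_iff[OF inv])
qed

lemma age_simplex_group:
  assumes "invertible (homogenized_matrix v)" "x \<in> simplex_group v"
  shows "real (nat \<lfloor>age x\<rfloor>) = age x"
proof -
  have "age x \<in> \<int>" "0 \<le> age x"
    using assms by (auto simp: simplex_group_def simplex_lattice_iff age_def intro: sum_nonneg)
  then show ?thesis by (auto elim!: Ints_cases)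
qed

lemma nat_age_simplex_group_le:
  fixes v :: "'n::finite option \<Rightarrow> real ^ 'n"
  assumes "invertible (homogenized_matrix v)" "x \<in> simplex_group v"
  shows "nat \<lfloor>age x\<rfloor> \<le> CARD('n)"
proof -
  \<comment> \<open>Each of the d + 1 coordinates is below 1, so the integral age is at most
    d.\<close>
  have "age x < (\<Sum>i\<in>(UNIV :: 'n option set). 1)"
    unfolding age_def using assms by (intro sum_strict_mono) (auto simp: simplex_group_def)
  then have "real (nat \<lfloor>age x\<rfloor>) < real (CARD('n) + 1)"
    by (simp only: age_simplex_group[OF assms] sum_constant card_option_UNIV) simp
  then show ?thesis by linarith
qed

text \<open>Fractional and integral parts give the bijection. The sum condition on \<open>f\<close>
  is additive, so elements of age above \<open>m\<close> contribute the empty set and no truncated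
  subtraction interferes.\<close>

lemma card_lattice_points_age:
  fixes v :: "'n::finite option \<Rightarrow> real ^ 'n"
  assumes inv: "invertible (homogenized_matrix v)" and int: "\<And>i. v i \<in> integer_points"
    and fin: "finite (simplex_group v)"
  shows "card {x \<in> simplex_lattice v. (\<forall>i. 0 \<le> x $ i) \<and> age x = real m} =
    (\<Sum>y\<in>simplex_group v. card {f :: 'n option \<Rightarrow> nat. sum f UNIV + nat \<lfloor>age y\<rfloor> = m})"
proof -
  define L where "L = {x \<in> simplex_lattice v. (\<forall>i. 0 \<le> x $ i) \<and> age x = real m}"
  define B where "B = (\<lambda>y :: real ^ 'n option. {f :: 'n option \<Rightarrow> nat. sum f UNIV + nat \<lfloor>age y\<rfloor> = m})"
  define G where "G = (\<lambda>(y, f :: 'n option \<Rightarrow> nat). y + (\<chi> i. real (f i)) :: real ^ 'n option)"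
  have age_G: "age (G (y, f)) = real (sum f UNIV) + age y" for y f
    by (simp add: G_def age_def sum.distrib)
  have lattice_G: "G (y, f) \<in> simplex_lattice v \<longleftrightarrow> y \<in> simplex_lattice v" for y f
    unfolding G_def by (simp add: simplex_lattice_add_integer[OF inv int] integer_points_def)
  have finB: "finite (B y)" for y
    by (rule finite_subset[OF _ finite_fun_sum_eq[of "m - nat \<lfloor>age y\<rfloor>"]]) (auto simp: B_def)
  have "bij_betw G (Sigma (simplex_group v) B) L"
  proof (rule bij_betw_imageI)
    show "inj_on G (Sigma (simplex_group v) B)"
    proof (rule inj_onI, clarify)
      fix y y' f f'
      assume y: "y \<in> simplex_group v" "y' \<in> simplex_group v" and eq: "G (y, f) = G (y', f')"
      have eq_i: "y $ i + real (f i) = y' $ i + real (f' i)" for i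
        using arg_cong[OF eq, of "\<lambda>x. x $ i"] by (simp add: G_def)
      have "f i = f' i" for i
      proof -
        have "0 \<le> y $ i" "y $ i < 1" "0 \<le> y' $ i" "y' $ i < 1"
          using y by (auto simp: simplex_group_def)
        with eq_i[of i] show ?thesis by linarith
      qed
      then have "f = f'" ..
      with eq_i show "y = y' \<and> f = f'" by (simp add: vec_eq_iff)
    qed
    show "G ` Sigma (simplex_group v) B = L"
    proof (intro equalityI subsetI)
      fix x assume "x \<in> G ` Sigma (simplex_group v) B"
      then obtain y f where yf: "y \<in> simplex_group v" "f \<in> B y" "x = G (y, f)" by auto
      have "age x = real (sum f UNIV + nat \<lfloor>age y\<rfloor>)"
        using age_simplex_group[OF inv yf(1)] yf(3) by (simp add: age_G)
      then have "age x = real m" using yf(2) unfolding B_def by (simp only: mem_Collect_eq)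
      moreover have "x \<in> simplex_lattice v" "\<forall>i. 0 \<le> x $ i"
        using yf by (simp_all add: lattice_G simplex_group_def) (simp add: G_def)
      ultimately show "x \<in> L" by (simp add: L_def)
    next
      fix x assume x: "x \<in> L"
      define y :: "real ^ 'n option" where "y = (\<chi> i. frac (x $ i))"
      define f where "f = (\<lambda>i. nat \<lfloor>x $ i\<rfloor>)"
      have xG: "x = G (y, f)"
        using x by (simp add: vec_eq_iff G_def y_def f_def L_def frac_def)
      have "y \<in> simplex_lattice v"
        using x lattice_G[of y f] unfolding xG[symmetric] by (simp add: L_def)
      then have y: "y \<in> simplex_group v"
        by (simp add: simplex_group_def) (simp add: y_def frac_lt_1)
      have "real (sum f UNIV + nat \<lfloor>age y\<rfloor>) = real m"
        using x age_simplex_group[OF inv y] age_G[of y f] unfolding xG[symmetric] by (simp add: L_def)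
      then have "f \<in> B y"
        unfolding B_def by (simp only: of_nat_eq_iff mem_Collect_eq)
      with y xG show "x \<in> G ` Sigma (simplex_group v) B" by auto
    qed
  qed
  from bij_betw_same_card[OF this] fin finB show ?thesis by (simp add: L_def B_def)
qed

text \<open>An element of age s contributes t^s / (1 - t)^(d+1) to the Ehrhart series. Ages are at
  most d, so the numerator meets the degree bound that identifies it as the h*-polynomial.\<close>

lemma hstar_simplex:
  fixes v :: "'n::finite option \<Rightarrow> real ^ 'n"
  assumes inv: "invertible (homogenized_matrix v)" and int: "\<And>i. v i \<in> integer_points"
    and fin: "finite (simplex_group v)"
  shows "hstar (convex hull (range v)) = (\<Sum>x\<in>simplex_group v. monom 1 (nat \<lfloor>age x\<rfloor>))"
proof (rule hstar_eqI)
  show "degree (\<Sum>x\<in>simplex_group v. monom (1 :: real) (nat \<lfloor>age x\<rfloor>)) \<le> CARD('n)"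
    using nat_age_simplex_group_le[OF inv] fin
    by (intro degree_sum_le) (auto simp: degree_monom_eq)
  let ?D = "(1 - fps_X :: real fps) ^ (CARD('n) + 1)"
  \<comment> \<open>Multiplication by \<open>fps_X ^ a\<close> shifts coefficients; the case split
    keeps \<open>m - a\<close> a genuine difference.\<close>
  have count: "fps_nth (fps_X ^ a * inverse ?D) m =
      of_nat (card {f :: 'n option \<Rightarrow> nat. sum f UNIV + a = m})" for a m
  proof (cases "m < a")
    case True
    then have "{f :: 'n option \<Rightarrow> nat. sum f UNIV + a = m} = {}" by auto
    with True show ?thesis by (simp add: fps_X_power_mult_nth del: power_Suc)
  next
    case False
    then have "{f :: 'n option \<Rightarrow> nat. sum f UNIV + a = m} = {f. sum f UNIV = m - a}" by auto
    with False show ?thesis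
      by (simp only: fps_X_power_mult_nth card_option_UNIV[symmetric]
          fps_nth_inverse_one_minus_X_power if_False)
  qed
  have "fps_of_poly (\<Sum>x\<in>simplex_group v. monom 1 (nat \<lfloor>age x\<rfloor>)) / ?D =
      (\<Sum>x\<in>simplex_group v. fps_X ^ nat \<lfloor>age x\<rfloor> * inverse ?D)"
    by (subst fps_divide_unit)
      (simp_all only: fps_of_poly_sum fps_of_poly_monom' sum_distrib_right,
        simp add: fps_nth_power_0 del: power_Suc)
  then show "ehrhart_series (convex hull (range v)) =
      fps_of_poly (\<Sum>x\<in>simplex_group v. monom 1 (nat \<lfloor>age x\<rfloor>)) / ?D"
    by (intro fps_ext)
      (simp only: ehrhart_series_def fps_nth_Abs_fps card_dilated_simplex_points[OF inv]
        card_lattice_points_age[OF assms] fps_sum_nth count of_nat_sum)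
qed

section \<open>The group of a one-row simplex\<close>

text \<open>The coordinate \<open>None\<close> is forced by the age being an integer.\<close>

definition hnf_group_element :: "nat \<Rightarrow> nat \<Rightarrow> real ^ 'n::finite option" where
  "hnf_group_element N j =
    (\<chi> i. case i of None \<Rightarrow> frac (- (real CARD('n) * real j / real N)) | Some c \<Rightarrow> real j / real N)"

text \<open>At coordinate \<open>l\<close> all unit vectors among the vertices vanish, so that
  coordinate involves \<open>x $ Some l\<close> alone. The system can therefore be solved starting
  from \<open>l\<close>.\<close>

lemma hnf_vertices_combination:
  fixes l c :: "'n::finite"
  shows "(\<Sum>i\<in>UNIV. x $ i *\<^sub>R hnf_vertices l a i) $ c =
    (if c = l then 0 else x $ Some c) + x $ Some l * of_int (a $ c)"
proof -
  have "(\<Sum>i\<in>UNIV. x $ i *\<^sub>R hnf_vertices l a i) $ c =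
      (\<Sum>j\<in>UNIV. x $ Some j * hnf_vertices l a (Some j) $ c)"
    by (simp add: sum_option_UNIV hnf_vertices_def)
  also have "\<dots> = x $ Some l * of_int (a $ c) +
      (\<Sum>j\<in>UNIV - {l}. x $ Some j * hnf_vertices l a (Some j) $ c)"
    by (subst sum.remove[of _ l]) (auto simp: hnf_vertices_def)
  also have "(\<Sum>j\<in>UNIV - {l}. x $ Some j * hnf_vertices l a (Some j) $ c) =
      (\<Sum>j\<in>UNIV - {l}. if j = c then x $ Some c else 0)"
    by (intro sum.cong) (auto simp: hnf_vertices_def axis_def)
  also have "\<dots> = (if c = l then 0 else x $ Some c)"
    by (simp add: sum.delta)
  finally show ?thesis by simp
qed

lemma invertible_homogenized_matrixI:
  fixes v :: "'n::finite option \<Rightarrow> real ^ 'n"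
  assumes "\<And>x. age x = 0 \<Longrightarrow> (\<Sum>i\<in>UNIV. x $ i *\<^sub>R v i) = 0 \<Longrightarrow> x = 0"
  shows "invertible (homogenized_matrix v)"
proof -
  let ?A = "homogenized_matrix v"
  have "x = 0" if "x v* ?A = 0" for x
  proof (rule assms)
    have coord: "(x v* ?A) $ j = 0" for j using that by simp
    show "age x = 0" using coord[of None] by (simp add: vector_homogenized_matrix)
    show "(\<Sum>i\<in>UNIV. x $ i *\<^sub>R v i) = 0"
      using coord[of "Some _"] by (simp add: vector_homogenized_matrix vec_eq_iff)
  qed
  \<comment> \<open>The kernel criterion concerns multiplication by column vectors, hence the
    transpose.\<close>
  then have "\<exists>B. B ** transpose ?A = mat 1"
    by (simp add: matrix_left_invertible_ker)
  then have "invertible (transpose ?A)"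
    by (simp only: invertible_left_inverse)
  then show ?thesis
    using transpose_invertible[of "transpose ?A"] by simp
qed

lemma invertible_hnf:
  assumes "a $ l \<noteq> 0"
  shows "invertible (homogenized_matrix (hnf_vertices l a))"
proof (rule invertible_homogenized_matrixI)
  fix x assume age: "age x = 0" and "(\<Sum>i\<in>UNIV. x $ i *\<^sub>R hnf_vertices l a i) = 0"
  then have c: "(if c = l then 0 else x $ Some c) + x $ Some l * of_int (a $ c) = 0" for c
    by (metis hnf_vertices_combination zero_index)
  have l: "x $ Some l = 0" using c[of l] assms by simp
  have Some: "x $ Some c = 0" for c using c[of c] l by (cases "c = l") auto
  with age have "x $ None = 0" by (simp add: age_def sum_option_UNIV)
  with Some show "x = 0" by (metis option.exhaust vec_eq_iff zero_index)
qed

lemma hnf_vertices_integer: "hnf_vertices l a i \<in> integer_points"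
  by (auto simp: hnf_vertices_def integer_points_def axis_def split: option.split)

text \<open>With s = d j / N, the sum s + frac (-s) equals the negated floor of -s, that is, the
  ceiling of s.\<close>

lemma age_hnf_group_element:
  "age (hnf_group_element N j :: real ^ 'n::finite option) = of_int \<lceil>real CARD('n) * real j / real N\<rceil>"
  by (simp add: age_def sum_option_UNIV hnf_group_element_def frac_def ceiling_def)

text \<open>Coordinate \<open>l\<close> puts \<open>x $ Some l\<close> into (1/N) \<int>. The
  entries N - 1 then make every \<open>x $ Some c\<close> congruent to it modulo 1, hence equal
  within [0, 1), and integrality of the age determines \<open>x $ None\<close>.\<close>

lemma simplex_group_hnf:
  fixes l :: "'n::finite"
  assumes N: "0 < N" and a: "a = (\<chi> i. if i = l then int N else int N - 1)"
  shows "simplex_group (hnf_vertices l a) = hnf_group_element N ` {..<N}"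
proof -
  have inv: "invertible (homogenized_matrix (hnf_vertices l a))"
    using N by (intro invertible_hnf) (simp add: a)
  have lattice: "x \<in> simplex_lattice (hnf_vertices l a) \<longleftrightarrow> age x \<in> \<int> \<and>
      (\<forall>c. (if c = l then 0 else x $ Some c) + x $ Some l * of_int (a $ c) \<in> \<int>)" for x
    by (simp only: simplex_lattice_iff[OF inv] integer_points_def mem_Collect_eq hnf_vertices_combination)
  show ?thesis
  proof (intro equalityI subsetI)
    fix x assume x: "x \<in> simplex_group (hnf_vertices l a)"
    then have x01: "0 \<le> x $ i" "x $ i < 1" for i by (auto simp: simplex_group_def)
    have agex: "age x \<in> \<int>"
      and c: "(if c = l then 0 else x $ Some c) + x $ Some l * of_int (a $ c) \<in> \<int>" for c
      using x by (auto simp: simplex_group_def lattice)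
    obtain z where z: "x $ Some l * real N = of_int z"
      using c[of l] by (auto simp: a elim: Ints_cases)
    have "0 \<le> real_of_int z" "real_of_int z < real N"
      using z x01[of "Some l"] N by (simp_all flip: z)
    then obtain j where j: "z = int j" "j < N"
      by (metis nonneg_int_cases of_int_0_le_iff of_int_less_iff of_int_of_nat_eq of_nat_less_iff)
    have xl: "x $ Some l = real j / real N"
      using z j N by (simp add: field_simps)
    have xc: "x $ Some c = real j / real N" for c
    proof (cases "c = l")
      case False
      have "x $ Some c + x $ Some l * (real N - 1) \<in> \<int>"
        using c[of c] False by (simp add: a)
      also have "x $ Some c + x $ Some l * (real N - 1) = (x $ Some c - real j / real N) + real j"
        using N by (simp add: xl field_simps)
      finally have "(x $ Some c - real j / real N) + real j - real j \<in> \<int>"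
        by (rule Ints_diff) simp
      then have "real j / real N - x $ Some c \<in> \<int>"
        by (metis Ints_minus add_diff_cancel_right' minus_diff_eq)
      then have "frac (real j / real N) = x $ Some c"
        using x01 by (simp add: frac_unique_iff)
      moreover have "frac (real j / real N) = real j / real N"
        using j(2) by (simp add: frac_eq)
      ultimately show ?thesis by simp
    qed (simp add: xl)
    have "- (real CARD('n) * real j / real N) - x $ None = - age x"
      by (simp add: age_def sum_option_UNIV xc)
    then have "- (real CARD('n) * real j / real N) - x $ None \<in> \<int>"
      using agex by (simp only: Ints_minus)
    then have "x $ None = frac (- (real CARD('n) * real j / real N))"
      using x01 by (metis frac_unique_iff)
    with xc have "x = hnf_group_element N j"
      by (simp add: vec_eq_iff hnf_group_element_def split: option.split)
    with j show "x \<in> hnf_group_element N ` {..<N}" by blast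
  next
    fix x :: "real ^ 'n option" assume "x \<in> hnf_group_element N ` {..<N}"
    then obtain j where j: "x = hnf_group_element N j" "j < N" by blast
    have "age x \<in> \<int>" by (simp add: j age_hnf_group_element)
    \<comment> \<open>For \<open>c = l\<close> this is (j/N) N, otherwise j/N + (j/N) (N -
      1).\<close>
    moreover have "(if c = l then 0 else x $ Some c) + x $ Some l * of_int (a $ c) = real j" for c
      using N by (simp add: j a hnf_group_element_def field_simps)
    ultimately have "x \<in> simplex_lattice (hnf_vertices l a)"
      by (simp add: lattice)
    then show "x \<in> simplex_group (hnf_vertices l a)"
      using j by (simp add: simplex_group_def)
        (simp add: hnf_group_element_def frac_lt_1 split: option.split)
  qed
qed

lemma inj_on_hnf_group_element: "inj_on (hnf_group_element N :: nat \<Rightarrow> real ^ 'n::finite option) {..<N}"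
proof (rule inj_onI)
  fix i j assume i: "i \<in> {..<N}"
    and eq: "(hnf_group_element N i :: real ^ 'n option) = hnf_group_element N j"
  have "(hnf_group_element N i :: real ^ 'n option) $ Some c = hnf_group_element N j $ Some c" for c
    by (simp only: eq)
  with i show "i = j"
    by (auto simp: hnf_group_element_def)
qed

section \<open>Interior elements, and both polynomials as sums over \<open>j\<close>\<close>

lemma real_nat_divide_in_Ints_iff:
  assumes "0 < n"
  shows "real m / real n \<in> \<int> \<longleftrightarrow> n dvd m"
proof
  assume "real m / real n \<in> \<int>"
  then obtain z where "real m / real n = of_int z" by (elim Ints_cases)
  then have "real_of_int (int m) = real_of_int (int n * z)"
    using assms by (simp add: field_simps)
  then have "int m = int n * z" by (simp only: of_int_eq_iff)
  then have "int n dvd int m" by (rule dvdI)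
  then show "n dvd m" by (simp only: int_dvd_int_iff)
qed (use assms in \<open>auto elim!: dvdE\<close>)

text \<open>The coordinate at \<open>None\<close> vanishes exactly when d j / N is an integer; the
  others vanish only for \<open>j = 0\<close>.\<close>

lemma hnf_group_element_interior_iff:
  assumes "0 < N" "j < N"
  shows "(\<forall>i. 0 < (hnf_group_element N j :: real ^ 'n::finite option) $ i) \<longleftrightarrow>
    0 < j \<and> \<not> N dvd CARD('n) * j"
proof -
  have "- (real CARD('n) * real j / real N) \<in> \<int> \<longleftrightarrow> real (CARD('n) * j) / real N \<in> \<int>"
    by (metis Ints_minus add.inverse_inverse of_nat_mult)
  also have "\<dots> \<longleftrightarrow> N dvd CARD('n) * j"
    using assms(1) by (rule real_nat_divide_in_Ints_iff)
  finally show ?thesis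
    using assms by (auto simp: hnf_group_element_def frac_gt_0_iff split_option_all zero_less_divide_iff)
qed


lemma hstar_hnf:
  fixes l :: "'n::finite"
  assumes N: "0 < N" and a: "a = (\<chi> i. if i = l then int N else int N - 1)"
  shows "hstar (hnf_simplex l a) = (\<Sum>j<N. monom 1 (nat \<lceil>real CARD('n) * real j / real N\<rceil>))"
proof -
  have "invertible (homogenized_matrix (hnf_vertices l a))"
    using N by (intro invertible_hnf) (simp add: a)
  then have "hstar (hnf_simplex l a) =
      (\<Sum>x\<in>(hnf_group_element N ` {..<N} :: (real ^ 'n option) set). monom 1 (nat \<lfloor>age x\<rfloor>))"
    unfolding hnf_simplex_def simplex_group_hnf[OF assms, symmetric]
    by (intro hstar_simplex hnf_vertices_integer) (simp_all add: simplex_group_hnf[OF assms])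
  then show ?thesis
    by (simp add: sum.reindex[OF inj_on_hnf_group_element] age_hnf_group_element)
qed

lemma local_hstar_hnf:
  fixes l :: "'n::finite"
  assumes N: "0 < N" and a: "a = (\<chi> i. if i = l then int N else int N - 1)"
  shows "local_hstar (hnf_vertices l a) =
    (\<Sum>j\<in>{j \<in> {..<N}. 0 < j \<and> \<not> N dvd CARD('n) * j}. monom 1 (nat \<lceil>real CARD('n) * real j / real N\<rceil>))"
proof -
  let ?J = "{j \<in> {..<N}. 0 < j \<and> \<not> N dvd CARD('n) * j}"
  have "{x \<in> simplex_group (hnf_vertices l a). \<forall>i. 0 < x $ i \<and> x $ i < 1} =
      {x \<in> simplex_group (hnf_vertices l a). \<forall>i. 0 < x $ i}"
    by (auto simp: simplex_group_def)
  also have "\<dots> = hnf_group_element N ` {j \<in> {..<N}. \<forall>i. 0 < (hnf_group_element N j :: real ^ 'n option) $ i}"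
    unfolding simplex_group_hnf[OF assms] by blast
  also have "\<dots> = hnf_group_element N ` ?J"
    using hnf_group_element_interior_iff[where 'n = 'n, OF N]
    by (intro image_cong refl Collect_cong conj_cong) auto
  finally show ?thesis
    unfolding local_hstar_def
    by (simp only:)
      (subst sum.reindex, rule inj_on_subset[OF inj_on_hnf_group_element],
        auto simp: age_hnf_group_element)
qed

section \<open>Ages in blocks of length \<open>k\<close>\<close>

text \<open>With q = (j - 1) div k, the claim is q N < d j \<le> (q + 1) N. The range includes j = d
  k even when this equals N and is no index of the group, so that all blocks are complete.\<close>

lemma nat_ceiling_mult_div:
  fixes d k N j :: nat
  assumes N: "N \<in> {d * k, d * k + 1}" and j: "0 < j" "j \<le> d * k"
  shows "nat \<lceil>real d * real j / real N\<rceil> = (j - 1) div k + 1"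
proof -
  define q where "q = (j - 1) div k"
  define r where "r = (j - 1) mod k"
  have k: "0 < k" and d: "0 < d" using j by (auto intro!: Nat.gr0I)
  have jq: "j = q * k + r + 1" using j by (simp add: q_def r_def)
  have r: "r < k" using k by (simp add: r_def)
  have N0: "0 < N" using N k d by auto
  have "q * k < d * k" using jq j by linarith
  then have q: "q < d" by simp
  \<comment> \<open>Here d j = d k q + d (r + 1). For N = d k the surplus d (r + 1) is positive; for
    N = d k + 1 it must exceed q, which follows from \<open>q < d\<close>.\<close>
  have "q * N < d * j"
    using N
  proof
    assume "N = d * k"
    then show ?thesis using d by (simp add: jq algebra_simps)
  next
    assume "N \<in> {d * k + 1}"
    then show ?thesis using q by (simp add: jq algebra_simps)
  qed
  moreover have "d * j \<le> (q + 1) * N"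
  proof -
    have "d * j \<le> d * ((q + 1) * k)"
      using r by (intro mult_left_mono) (simp_all add: jq)
    also have "\<dots> = (q + 1) * (d * k)" by (rule mult.left_commute)
    also have "\<dots> \<le> (q + 1) * N" using N by (intro mult_left_mono) auto
    finally show ?thesis .
  qed
  ultimately have "real (q * N) < real (d * j)" "real (d * j) \<le> real ((q + 1) * N)"
    by (simp_all only: of_nat_less_iff of_nat_le_iff)
  then have "\<lceil>real d * real j / real N\<rceil> = int q + 1"
    using N0 by (intro ceiling_unique) (simp_all add: field_simps)
  then show ?thesis by (simp add: q_def)
qed

text \<open>After a shift by one, the range splits into \<open>d\<close> intervals of length
  \<open>k\<close>, on each of which the quotient is constant.\<close>

lemma sum_blocks:
  fixes g :: "nat \<Rightarrow> 'a::comm_semiring_1"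
  assumes "0 < k"
  shows "(\<Sum>j = 1..d * k. g ((j - 1) div k + 1)) = of_nat k * (\<Sum>i = 1..d. g i)"
proof -
  have "(\<Sum>j = 1..d * k. g ((j - 1) div k + 1)) = (\<Sum>j<d * k. g (j div k + 1))"
    by (rule sum.reindex_bij_witness[of _ Suc "\<lambda>j. j - 1"]) auto
  also have "\<dots> = (\<Sum>i<d. \<Sum>j = i * k..<i * k + k. g (j div k + 1))"
    by (rule sum.nat_group[symmetric])
  also have "\<dots> = (\<Sum>i<d. of_nat k * g (i + 1))"
  proof (intro sum.cong refl)
    fix i
    have "g (j div k + 1) = g (i + 1)" if "j \<in> {i * k..<i * k + k}" for j
      using that by (intro arg_cong[of _ _ g]) (simp add: div_nat_eqI mult.commute)
    then show "(\<Sum>j = i * k..<i * k + k. g (j div k + 1)) = of_nat k * g (i + 1)"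
      by simp
  qed
  also have "\<dots> = of_nat k * (\<Sum>i<d. g (i + 1))"
    by (simp add: sum_distrib_left)
  also have "(\<Sum>i<d. g (i + 1)) = (\<Sum>i = 1..d. g i)"
    by (rule sum.reindex_bij_witness[of _ "\<lambda>j. j - 1" Suc]) auto
  finally show ?thesis .
qed

theorem theorem2:
  fixes d k N :: nat and l :: "'n::finite" and a :: "int ^ 'n"
  assumes "d = CARD('n)" and "1 \<le> d" and "1 \<le> k"
    and "N \<in> {d * k, d * k + 1}"
    and "a = (\<chi> i. if i = l then int N else int N - 1)"
  shows "hstar (hnf_simplex l a) =
           (if N = d * k
            then 1 + smult (real k) (\<Sum>j = 1..d - 1. monom 1 j) + monom (real k - 1) d
            else 1 + smult (real k) (\<Sum>j = 1..d. monom 1 j)) \<and>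
         local_hstar (hnf_vertices l a) =
           (if N = d * k
            then smult (real k - 1) (\<Sum>i = 1..d. monom 1 i)
            else smult (real k) (\<Sum>i = 1..d. monom 1 i))"
proof -
  define e where "e = (\<lambda>j. nat \<lceil>real d * real j / real N\<rceil>)"
  define M where "M = (\<lambda>i. monom (1 :: real) i)"
  have N: "0 < N" using assms by auto
  have k: "0 < k" using assms by simp
  have e: "e j = (j - 1) div k + 1" if "j \<in> {1..d * k}" for j
    unfolding e_def using that by (intro nat_ceiling_mult_div[OF assms(4)]) auto
  have "(\<Sum>j = 1..d * k. M (e j)) = (\<Sum>j = 1..d * k. M ((j - 1) div k + 1))"
    by (intro sum.cong refl arg_cong[of _ _ M] e)
  then have block: "(\<Sum>j = 1..d * k. M (e j)) = smult (real k) (\<Sum>i = 1..d. M i)"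
    unfolding sum_blocks[OF k] by (simp add: of_nat_poly)
  have hstar: "hstar (hnf_simplex l a) = (\<Sum>j<N. M (e j))"
    using hstar_hnf[OF N assms(5)] by (simp add: M_def e_def assms(1))
  have local_hstar: "local_hstar (hnf_vertices l a) =
      (\<Sum>j\<in>{j \<in> {..<N}. 0 < j \<and> \<not> N dvd d * j}. M (e j))"
    using local_hstar_hnf[OF N assms(5)] by (simp add: M_def e_def assms(1))
  \<comment> \<open>The neutral element \<open>j = 0\<close> has age 0 and yields the constant term
    1.\<close>
  have "{..<N} = insert 0 {1..<N}" using N by auto
  then have zero: "(\<Sum>j<N. M (e j)) = 1 + (\<Sum>j = 1..<N. M (e j))"
    by (simp add: e_def M_def)
  show ?thesis
  proof (cases "N = d * k")
    case True
    have e_mult: "e (i * k) = i" for i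
      using k assms(2) by (simp add: e_def True)
    \<comment> \<open>The last block runs up to j = N, one beyond the group. Removing this term of
      age d lowers the coefficient of t^d to k - 1.\<close>
    have "{1..d * k} = insert (d * k) {1..<N}" using N True by auto
    then have "(\<Sum>j = 1..d * k. M (e j)) = M d + (\<Sum>j = 1..<N. M (e j))"
      by (simp add: True e_mult)
    moreover have "{1..d} = insert d {1..d - 1}" using assms(2) by auto
    then have "(\<Sum>i = 1..d. M i) = M d + (\<Sum>i = 1..d - 1. M i)"
      using assms(2) by simp
    moreover have "smult (real k) (M d) - M d = monom (real k - 1) d"
      by (simp add: M_def smult_monom diff_monom)
    ultimately have "(\<Sum>j = 1..<N. M (e j)) =
        smult (real k) (\<Sum>j = 1..d - 1. M j) + monom (real k - 1) d"
      using block by (simp add: smult_add_right algebra_simps)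
    then have h: "hstar (hnf_simplex l a) =
        1 + smult (real k) (\<Sum>j = 1..d - 1. M j) + monom (real k - 1) d"
      by (simp add: hstar zero)
    \<comment> \<open>As N = d k, the divisibility means that \<open>k\<close> divides
      \<open>j\<close>. The extra index d k is itself a multiple of \<open>k\<close>, so it is
      removed as well.\<close>
    have "{j \<in> {..<N}. 0 < j \<and> \<not> N dvd d * j} = {1..d * k} - (\<lambda>i. i * k) ` {1..d}"
    proof (intro equalityI subsetI)
      fix j assume "j \<in> {j \<in> {..<N}. 0 < j \<and> \<not> N dvd d * j}"
      then show "j \<in> {1..d * k} - (\<lambda>i. i * k) ` {1..d}"
        using True assms(2) by auto
    next
      fix j assume j: "j \<in> {1..d * k} - (\<lambda>i. i * k) ` {1..d}"
      have "\<not> k dvd j"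
      proof
        assume "k dvd j"
        then obtain i where "j = i * k" by (metis dvdE mult.commute)
        with j k show False by (auto intro!: Nat.gr0I)
      qed
      then have "j \<noteq> d * k" by auto
      with j \<open>\<not> k dvd j\<close> show "j \<in> {j \<in> {..<N}. 0 < j \<and> \<not> N dvd d * j}"
        using True assms(2) by auto
    qed
    then have "local_hstar (hnf_vertices l a) =
        (\<Sum>j = 1..d * k. M (e j)) - (\<Sum>j\<in>(\<lambda>i. i * k) ` {1..d}. M (e j))"
      using k by (simp add: local_hstar sum_diff image_subset_iff)
    \<comment> \<open>Each block contains one multiple of \<open>k\<close>, namely its last index i
      k, of age i; every multiplicity drops from k to k - 1.\<close>
    also have "(\<Sum>j\<in>(\<lambda>i. i * k) ` {1..d}. M (e j)) = (\<Sum>i = 1..d. M i)"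
      using k by (subst sum.reindex) (auto simp: inj_on_def e_mult)
    finally have "local_hstar (hnf_vertices l a) = smult (real k - 1) (\<Sum>i = 1..d. M i)"
      unfolding block by (simp add: smult_diff_left)
    with h True show ?thesis by (simp add: M_def)
  next
    case False
    then have Ndk: "N = d * k + 1" using assms(4) by simp
    \<comment> \<open>A common divisor of N and d divides N - d k = 1. Hence every nonzero
      \<open>j < N\<close> gives an interior element.\<close>
    then have "coprime N d"
      by (intro coprimeI) (metis dvd_add_right_iff dvd_mult2)
    then have "\<not> N dvd d * j" if "0 < j" "j < N" for j
      using that by (simp add: coprime_dvd_mult_right_iff nat_dvd_not_less)
    then have "{j \<in> {..<N}. 0 < j \<and> \<not> N dvd d * j} = {1..<N}" by auto
    moreover have "{1..<N} = {1..d * k}" using Ndk by auto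
    ultimately have "hstar (hnf_simplex l a) = 1 + smult (real k) (\<Sum>i = 1..d. M i)"
      "local_hstar (hnf_vertices l a) = smult (real k) (\<Sum>i = 1..d. M i)"
      by (simp_all only: hstar local_hstar zero block)
    with False show ?thesis by (simp add: M_def)
  qed
qed

end
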